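(* Let $G$, $y$, $w$ be analytic functions and $c\in\mathbb{C}$ a constant such that, for $A$ in a region of the upper half plane and $q=e^{2\pi i A}$, $$5\int_0^{y(A)}\frac{G(t)}{t\sqrt[6]{t^{-5}-11-t^5}}\,dt=A,\qquad 5\int_0^{y(A)}\frac{dt}{t\sqrt[6]{t^{-5}-11-t^5}}=-\frac{w(q)}{2\pi i}+\frac{c}{2\pi i}.$$ Then there is a constant $c'^{*}$ such that, for $A$ in this region and $q=e^{2\pi iA}$, $$\int_{c'^{*}}^{-w(q)/(2\pi i)+c/(2\pi i)}G(F_1(t))\,dt=A .$$
   Context: $F_1$ denotes the (local) inverse function of $x\mapsto 5\int_0^x \frac{dt}{t\sqrt[6]{t^{-5}-11-t^5}}$, i.e. $5\int_0^{F_1(A)}\frac{dt}{t\sqrt[6]{t^{-5}-11-t^5}}=A$, so that $F_1'(A)=\frac15 F_1(A)\sqrt[6]{F_1(A)^{-5}-11-F_1(A)^5}$. The function $w(q)$ is the solution, analytic near $q=0$ with $w(0)=0$, $w'(0)\ne0$, of a Lagrange equation $w/f(w)=q$ with $f$ analytic and non-vanishing near $0$. All identities are understood on (connected) regions where the functions involved are analytic, with consistent branches of the sixth root and with the integrals taken along paths on which the integrands are analytic. *)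

theory Defs
  imports "HOL-Complex_Analysis.Complex_Analysis"
begin

definition region :: "complex set \<Rightarrow> bool" where
  "region S \<longleftrightarrow> open S \<and> connected S \<and> S \<noteq> {}"

text \<open>
  Paths from \<open>a\<close> to \<open>z\<close> that run inside \<open>U\<close> except possibly for the starting point, which may be
  a boundary point of \<open>U\<close> where the integrand is singular (such as the point \<open>0\<close> for
  \<open>1 / (t * (t powi (-5) - 11 - t ^ 5) powr (1/6))\<close>). Smoothness is therefore
  required only away from the start. The predicate \<open>has_contour_integral\<close> is a
  Henstock--Kurzweil integral over \<open>{0..1}\<close>, so along such a path it is the improper integral.
\<close>

definition path_from_in :: "complex set \<Rightarrow> complex \<Rightarrow> complex \<Rightarrow> (real \<Rightarrow> complex) \<Rightarrow> bool" where
  "path_from_in U a z \<gamma> \<longleftrightarrow>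
     path \<gamma> \<and> pathstart \<gamma> = a \<and> pathfinish \<gamma> = z \<and> \<gamma> ` {0<..1} \<subseteq> U \<and>
     (\<forall>\<epsilon>\<in>{0<..<1}. \<gamma> piecewise_C1_differentiable_on {\<epsilon>..1})"

text \<open>
  \<open>path_integral U f a z\<close> is the integral of \<open>f\<close> from \<open>a\<close> to \<open>z\<close> inside \<open>U\<close>. It is meaningful when
  \<open>path_integrable U f a z\<close> holds: \<open>f\<close> is holomorphic on \<open>U\<close>, there is a path, and all paths
  give the same value.
\<close>

definition path_integrable ::
    "complex set \<Rightarrow> (complex \<Rightarrow> complex) \<Rightarrow> complex \<Rightarrow> complex \<Rightarrow> bool" where
  "path_integrable U f a z \<longleftrightarrow>
     f holomorphic_on U \<and> (\<exists>\<gamma>. path_from_in U a z \<gamma>) \<and>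
     (\<exists>I. \<forall>\<gamma>. path_from_in U a z \<gamma> \<longrightarrow> (f has_contour_integral I) \<gamma>)"

definition path_integral ::
    "complex set \<Rightarrow> (complex \<Rightarrow> complex) \<Rightarrow> complex \<Rightarrow> complex \<Rightarrow> complex" where
  "path_integral U f a z =
     (THE I. \<forall>\<gamma>. path_from_in U a z \<gamma> \<longrightarrow> (f has_contour_integral I) \<gamma>)"

definition sixth_root_branch :: "complex set \<Rightarrow> (complex \<Rightarrow> complex) \<Rightarrow> bool" where
  "sixth_root_branch U \<rho> \<longleftrightarrow>
     0 \<notin> U \<and> \<rho> holomorphic_on U \<and> (\<forall>t\<in>U. \<rho> t ^ 6 = t powi (-5) - 11 - t ^ 5)"

text \<open>
  \<open>F1\<close> on \<open>V\<close> is the inverse of \<open>x \<mapsto> 5 * (integral from 0 to x of 1 / (t * \<rho> t))\<close> on \<open>U\<close>.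
  The last conjunct is \<open>F1 0 = 0\<close>, stated as a limit because \<open>0\<close> is a branch point on
  the boundary of \<open>V\<close>.
\<close>

definition local_inverse_F1 ::
    "complex set \<Rightarrow> (complex \<Rightarrow> complex) \<Rightarrow> complex set \<Rightarrow> (complex \<Rightarrow> complex) \<Rightarrow> bool" where
  "local_inverse_F1 U \<rho> V F1 \<longleftrightarrow>
     (\<forall>x\<in>U. path_integrable U (\<lambda>t. 1 / (t * \<rho> t)) 0 x) \<and>
     homeomorphism U V (\<lambda>x. 5 * path_integral U (\<lambda>t. 1 / (t * \<rho> t)) 0 x) F1 \<and>
     F1 holomorphic_on V \<and> (F1 \<longlongrightarrow> 0) (at 0 within V)"

definition lagrange_solution :: "(complex \<Rightarrow> complex) \<Rightarrow> (complex \<Rightarrow> complex) \<Rightarrow> bool" where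
  "lagrange_solution f w \<longleftrightarrow>
     f analytic_on {0} \<and> (\<forall>\<^sub>F z in nhds 0. f z \<noteq> 0) \<and>
     w analytic_on {0} \<and> w 0 = 0 \<and> deriv w 0 \<noteq> 0 \<and>
     (\<forall>\<^sub>F q in nhds 0. w q / f (w q) = q)"

end

theory Submission
  imports Defs
begin

text \<open>
  The base point \<open>c' = 0\<close> works: \<open>F1\<close> maps a path in \<open>V\<close> from \<open>0\<close> to \<open>u A\<close> to a path in \<open>U\<close> from
  \<open>0\<close> to \<open>y A\<close>. The integral \<open>\<Phi> x = 5 * (integral from 0 to x of 1 / (t * \<rho> t))\<close> has derivative
  \<open>5 / (x * \<rho> x)\<close>, so \<open>F1' = F1 * \<rho> F1 / 5\<close>, and the integrand of \<open>G \<circ> F1\<close> along the first path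
  agrees with that of \<open>5 * G t / (t * \<rho> t)\<close> along the second at every parameter where the path
  is differentiable, which is all but countably many. No limit of truncated integrals is needed,
  although the integrals are improper at \<open>0\<close>. Finally, a path in \<open>V\<close> from \<open>0\<close> to \<open>u A\<close> exists
  because \<open>\<Phi>\<close> tends to \<open>0\<close> along paths that start at \<open>0\<close>.
\<close>

section \<open>Paths whose starting point may be singular\<close>

lemma countable_imp_negligible:
  fixes S :: "'a::euclidean_space set"
  assumes "countable S"
  shows "negligible S"
  using negligible_countable_Union[of "(\<lambda>x. {x}) ` S"] assms by auto

text \<open>Bad parameters may accumulate at \<open>0\<close>, so finiteness can fail. Exhausting
  \<open>{0<..1}\<close> by countably many closed intervals, each with finitely many of them, still
  leaves a countable and hence negligible set, which integrals ignore.\<close>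

lemma path_from_in_countable_nondifferentiable:
  assumes "path_from_in U a z \<gamma>"
  shows "countable {t \<in> {0<..1}. \<not> \<gamma> differentiable at t}"
proof -
  \<comment> \<open>\<open>Suc (Suc n)\<close> instead of \<open>Suc n\<close> keeps the left end
    strictly below \<open>1\<close>, as the smoothness clause of \<open>path_from_in\<close>
    demands.\<close>
  have "\<exists>S. finite S \<and> (\<forall>t\<in>{inverse (Suc (Suc n))..1} - S. \<gamma> differentiable at t)" for n :: nat
  proof -
    have "\<gamma> piecewise_C1_differentiable_on {inverse (Suc (Suc n))..1}"
      using assms by (auto simp: path_from_in_def inverse_eq_divide)
    then show ?thesis
      by (auto simp: piecewise_C1_differentiable_on_def C1_differentiable_on_eq)
  qed
  then obtain S where fin: "\<And>n::nat. finite (S n)"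
    and S: "\<And>n t. t \<in> {inverse (Suc (Suc n))..1} - S n \<Longrightarrow> \<gamma> differentiable at t"
    by metis
  have "{t \<in> {0<..1}. \<not> \<gamma> differentiable at t} \<subseteq> (\<Union>n. S n)"
  proof
    fix t assume t: "t \<in> {t \<in> {0<..1}. \<not> \<gamma> differentiable at t}"
    then obtain n where "inverse (Suc n) < t"
      using reals_Archimedean by auto
    moreover have "inverse (real (Suc (Suc n))) \<le> inverse (Suc n)"
      by (intro le_imp_inverse_le) auto
    ultimately have "inverse (real (Suc (Suc n))) \<le> t"
      by linarith
    then have "t \<in> {inverse (Suc (Suc n))..1}"
      using t by simp
    then show "t \<in> (\<Union>n. S n)"
      using S[of t n] t by blast
  qed
  then show ?thesis
    by (rule countable_subset) (simp add: fin countable_finite)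
qed

text \<open>Makes a partial integral along \<open>\<gamma>\<close> a full path integral to an
  intermediate point, to which path independence applies.\<close>

lemma path_from_in_initial_segment:
  assumes \<gamma>: "path_from_in U a z \<gamma>" and T: "T \<in> {0<..1}"
  shows "path_from_in U a (\<gamma> T) (\<lambda>t. \<gamma> (T * t))"
proof -
  have cont: "continuous_on {0..1} \<gamma>"
    using \<gamma> by (simp add: path_from_in_def path_def)
  have "(\<lambda>t. \<gamma> (T * t)) piecewise_C1_differentiable_on {\<epsilon>..1}" if "\<epsilon> \<in> {0<..<1}" for \<epsilon>
  proof -
    have "T * \<epsilon> \<in> {0<..<1}"
      using T that by (auto intro: mult_le_one le_less_trans[of "T * \<epsilon>" "1 * \<epsilon>"])
    then have "\<gamma> piecewise_C1_differentiable_on {T * \<epsilon>..1}"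
      using \<gamma> by (simp add: path_from_in_def)
    moreover have "(\<lambda>x. T * x + 0) ` {\<epsilon>..1} \<subseteq> {T * \<epsilon>..1}"
      using T that by (auto intro: mult_le_one)
    ultimately have "\<gamma> piecewise_C1_differentiable_on ((\<lambda>x. T * x + 0) ` {\<epsilon>..1})"
      by (rule piecewise_C1_differentiable_on_subset)
    from piecewise_C1_differentiable_affine[OF this] show ?thesis
      by (simp add: o_def)
  qed
  moreover have "path (\<lambda>t. \<gamma> (T * t))"
    unfolding path_def using T
    by (intro continuous_on_compose2[OF cont] continuous_intros) (auto intro: mult_le_one)
  moreover have "T * t \<in> {0<..1}" if "t \<in> {0<..1}" for t
    using T that by (auto intro: mult_le_one)
  ultimately show ?thesis
    using \<gamma> unfolding path_from_in_def pathstart_def pathfinish_def by auto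
qed

lemma path_from_in_join_linepath:
  assumes \<gamma>: "path_from_in U a x \<gamma>" and "closed_segment x z \<subseteq> U"
  shows "path_from_in U a z (\<gamma> +++ linepath x z)"
proof -
  have "\<gamma> +++ linepath x z piecewise_C1_differentiable_on {\<epsilon>..1}" if \<epsilon>: "\<epsilon> \<in> {0<..<1/2}" for \<epsilon>
  proof -
    have "\<gamma> piecewise_C1_differentiable_on {2 * \<epsilon>..1}"
      using \<gamma> \<epsilon> by (simp add: path_from_in_def)
    moreover have "(\<lambda>t. 2 * t + 0) ` {\<epsilon>..1/2} = {2 * \<epsilon>..1}"
      using \<epsilon> by (auto simp: image_affinity_atLeastAtMost)
    ultimately have 1: "(\<lambda>t. \<gamma> (2 * t)) piecewise_C1_differentiable_on {\<epsilon>..1/2}"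
      using piecewise_C1_differentiable_affine[of \<gamma> 2 0 "{\<epsilon>..1/2}"] by (simp add: o_def)
    have "linepath x z piecewise_C1_differentiable_on {0..1}"
      using valid_path_linepath by (simp only: valid_path_def)
    moreover have "(\<lambda>t. 2 * t + (-1)) ` {1/2..1} = {0..1::real}"
      unfolding image_affinity_atLeastAtMost by auto
    ultimately have 2: "(\<lambda>t. linepath x z (2 * t - 1)) piecewise_C1_differentiable_on {1/2..1}"
      using piecewise_C1_differentiable_affine[of "linepath x z" 2 "-1" "{1/2..1}"]
      by (simp add: o_def)
    have "\<gamma> 1 = x"
      using \<gamma> by (simp add: path_from_in_def pathfinish_def)
    then show ?thesis
      unfolding joinpaths_def using \<epsilon> 1 2
      by (intro piecewise_C1_differentiable_cases) (auto simp: linepath_def)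
  qed
  \<comment> \<open>So far the left end was below \<open>1/2\<close>, to have the joint inside the
    interval. A general \<open>\<epsilon>\<close> follows by restriction from
    \<open>\<epsilon>/4\<close>, which is below \<open>1/4\<close>.\<close>
  then have "\<gamma> +++ linepath x z piecewise_C1_differentiable_on {\<epsilon>..1}" if "\<epsilon> \<in> {0<..<1}" for \<epsilon>
    using that by (rule_tac piecewise_C1_differentiable_on_subset[of _ "{\<epsilon>/4..1}"]) auto
  moreover have "(\<gamma> +++ linepath x z) ` {0<..1} \<subseteq> U"
  proof clarify
    fix t :: real assume t: "t \<in> {0<..1}"
    show "(\<gamma> +++ linepath x z) t \<in> U"
    proof (cases "t \<le> 1/2")
      case True
      then have "2 * t \<in> {0<..1}" using t by auto
      then show ?thesis using \<gamma> True by (auto simp: path_from_in_def joinpaths_def)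
    next
      case False
      then have "2 * t - 1 \<in> {0..1}" using t by auto
      then have "linepath x z (2 * t - 1) \<in> closed_segment x z"
        by (metis image_eqI path_image_def path_image_linepath)
      then show ?thesis using False assms(2) by (auto simp: joinpaths_def)
    qed
  qed
  ultimately show ?thesis
    using \<gamma> by (auto simp: path_from_in_def)
qed

section \<open>Path integrals as functions of the endpoint\<close>

lemma path_integral_eqI:
  assumes "path_integrable U f a z" "path_from_in U a z \<gamma>" "(f has_contour_integral I) \<gamma>"
  shows "path_integral U f a z = I"
  unfolding path_integral_def
  using assms has_contour_integral_unique
  by (intro the_equality) (auto simp: path_integrable_def, (metis | blast)+)

lemma has_contour_integral_path_integral:
  assumes "path_integrable U f a z" "path_from_in U a z \<gamma>"
  shows "(f has_contour_integral path_integral U f a z) \<gamma>"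
  using assms path_integral_eqI[OF assms] by (auto simp: path_integrable_def)

text \<open>The rescaled path with parameter \<open>T * t\<close> is admissible up to
  \<open>\<gamma> T\<close>, and a linear substitution identifies its integral with the partial one.
  The path integral thus becomes an indefinite Henstock-Kurzweil integral in \<open>T\<close>, which
  is continuous and additive without any absolute convergence.\<close>

lemma path_integral_along_path:
  assumes int: "\<And>x. x \<in> U \<Longrightarrow> path_integrable U f a x"
    and \<gamma>: "path_from_in U a z \<gamma>" and T: "T \<in> {0<..1}"
  shows "path_integral U f a (\<gamma> T) =
           integral {0..T} (\<lambda>t. f (\<gamma> t) * vector_derivative \<gamma> (at t within {0..1}))"
    (is "_ = integral _ ?F")
proof -
  have inU: "\<gamma> t \<in> U" if "t \<in> {0<..1}" for t
    using \<gamma> that by (auto simp: path_from_in_def)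
  have "\<gamma> 1 = z"
    using \<gamma> by (simp add: path_from_in_def pathfinish_def)
  then have "?F integrable_on {0..1}"
    using has_contour_integral_path_integral[OF int \<gamma>] inU[of 1]
    by (auto simp: has_contour_integral_def integrable_on_def)
  then have "?F integrable_on {0..T}"
    by (rule integrable_on_subinterval) (use T in auto)
  then have "(?F has_integral integral {0..T} ?F) {0..T}"
    by (rule integrable_integral)
  from has_integral_stretch_real[OF this, of T]
  have "((\<lambda>t. ?F (T * t)) has_integral (1 / T) *\<^sub>R integral {0..T} ?F) {0..1}"
    using T by simp
  \<comment> \<open>The factor \<open>T\<close> moves into the integrand, where it serves as the
    inner derivative of the rescaled path.\<close>
  from has_integral_cmul[OF this, of T]
  have *: "((\<lambda>t. T *\<^sub>R ?F (T * t)) has_integral integral {0..T} ?F) {0..1}"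
    using T by simp
  let ?N = "{t \<in> {0<..1}. \<not> \<gamma> differentiable at t}"
  \<comment> \<open>Division by \<open>T\<close> carries the bad parameters of
    \<open>\<gamma>\<close> to those of the rescaled path; \<open>0\<close> is included because
    smoothness is not assumed there.\<close>
  have "negligible ((\<lambda>t. t / T) ` ?N \<union> {0, 1})"
    using path_from_in_countable_nondifferentiable[OF \<gamma>]
    by (intro countable_imp_negligible) auto
  moreover have "f (\<gamma> (T * t)) * vector_derivative (\<lambda>t. \<gamma> (T * t)) (at t within {0..1}) = T *\<^sub>R ?F (T * t)"
    if t: "t \<in> {0..1} - ((\<lambda>t. t / T) ` ?N \<union> {0, 1})" for t
  proof -
    have Tt: "T * t \<in> {0<..1}"
      using t T by (auto intro: mult_le_one)
    moreover have "t = (T * t) / T"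
      using T by simp
    ultimately have "\<gamma> differentiable at (T * t)"
      using t by blast
    then have D: "(\<gamma> has_vector_derivative vector_derivative \<gamma> (at (T * t))) (at (T * t))"
      by (simp add: vector_derivative_works)
    have "((\<lambda>t. T * t) has_vector_derivative T) (at t)"
      by (auto intro!: derivative_eq_intros)
    from vector_diff_chain_at[OF this D]
    have "((\<lambda>t. \<gamma> (T * t)) has_vector_derivative T *\<^sub>R vector_derivative \<gamma> (at (T * t))) (at t)"
      by (simp add: o_def)
    then have "vector_derivative (\<lambda>t. \<gamma> (T * t)) (at t within {0..1}) = T *\<^sub>R vector_derivative \<gamma> (at (T * t))"
      using t by (intro vector_derivative_at_within_ivl) auto
    moreover have "vector_derivative \<gamma> (at (T * t) within {0..1}) = vector_derivative \<gamma> (at (T * t))"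
      using Tt by (intro vector_derivative_at_within_ivl D) auto
    ultimately show ?thesis by simp
  qed
  ultimately have "(f has_contour_integral integral {0..T} ?F) (\<lambda>t. \<gamma> (T * t))"
    unfolding has_contour_integral_def using * by (rule has_integral_spike)
  then show ?thesis
    using path_integral_eqI[OF int path_from_in_initial_segment[OF \<gamma> T]] inU[OF T] by blast
qed

text \<open>This is continuity of the indefinite integral at \<open>0\<close>. It controls the
  approach to \<open>a\<close> along an admissible path only, which suffices to give an image path
  its starting point.\<close>

lemma path_integral_tendsto_0:
  assumes int: "\<And>x. x \<in> U \<Longrightarrow> path_integrable U f a x"
    and \<gamma>: "path_from_in U a z \<gamma>"
  shows "((\<lambda>t. path_integral U f a (\<gamma> t)) \<longlongrightarrow> 0) (at 0 within {0..1})"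
proof -
  let ?F = "\<lambda>t. f (\<gamma> t) * vector_derivative \<gamma> (at t within {0..1})"
  have "z \<in> U"
    using \<gamma> by (auto simp: path_from_in_def pathfinish_def)
  then have "?F integrable_on {0..1}"
    using has_contour_integral_path_integral[OF int \<gamma>]
    by (auto simp: has_contour_integral_def integrable_on_def)
  then have "continuous_on {0..1} (\<lambda>T. integral {0..T} ?F)"
    by (rule indefinite_integral_continuous_1)
  then have "((\<lambda>T. integral {0..T} ?F) \<longlongrightarrow> 0) (at 0 within {0..1})"
    by (force simp: continuous_on_def)
  \<comment> \<open>The parameter \<open>0\<close> is left out: \<open>\<gamma> 0 = a\<close> may
    lie outside \<open>U\<close>, where nothing is known about the path integral.\<close>
  moreover have "\<forall>\<^sub>F T in at 0 within {0..1}. integral {0..T} ?F = path_integral U f a (\<gamma> T)"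
    using path_integral_along_path[OF int \<gamma>] by (auto simp: eventually_at_filter)
  ultimately show ?thesis
    by (rule Lim_transform_eventually)
qed

text \<open>On a disc around \<open>x\<close> the function \<open>f\<close> has a primitive
  \<open>P\<close>. Extending one fixed path to \<open>x\<close> by straight segments shows that the
  path integral differs from \<open>P\<close> by a constant on the disc.\<close>

lemma path_integral_has_field_derivative:
  assumes "open U" and int: "\<And>x. x \<in> U \<Longrightarrow> path_integrable U f a x" and x: "x \<in> U"
  shows "(path_integral U f a has_field_derivative f x) (at x)"
proof -
  obtain r where r: "r > 0" "ball x r \<subseteq> U"
    using \<open>open U\<close> x openE by blast
  have "f holomorphic_on ball x r"
    using int[OF x] r holomorphic_on_subset by (auto simp: path_integrable_def)
  then obtain P where "\<And>v. v \<in> ball x r \<Longrightarrow> (P has_field_derivative f v) (at v within ball x r)"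
    using holomorphic_convex_primitive'[OF convex_ball open_ball] by blast
  then have P: "(P has_field_derivative f v) (at v)" if "v \<in> ball x r" for v
    using that at_within_open[OF that] by force
  obtain \<gamma> where \<gamma>: "path_from_in U a x \<gamma>"
    using int[OF x] by (auto simp: path_integrable_def)
  have eq: "P v - P x + path_integral U f a x = path_integral U f a v" if v: "v \<in> ball x r" for v
  proof -
    have seg: "closed_segment x v \<subseteq> ball x r"
      using v r by (intro closed_segment_subset) auto
    define \<delta> where "\<delta> = \<gamma> +++ linepath x v"
    let ?F = "\<lambda>t. f (\<delta> t) * vector_derivative \<delta> (at t within {0..1})"
    have \<delta>: "path_from_in U a v \<delta>"
      unfolding \<delta>_def using path_from_in_join_linepath[OF \<gamma>] seg r by blast
    have half: "\<delta> (1/2) = x" and one: "\<delta> 1 = v"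
      using \<gamma> by (auto simp: \<delta>_def joinpaths_def path_from_in_def pathfinish_def linepath_def)
    \<comment> \<open>At \<open>1/2\<close> the joined path still follows \<open>\<gamma>\<close>,
      but both pieces have the value \<open>x\<close> there.\<close>
    have line: "\<delta> t = linepath x v (2 * t - 1)" if "t \<ge> 1/2" for t
    proof (cases "t = 1/2")
      case True
      then show ?thesis using half by (simp only: True) (simp add: linepath_def)
    next
      case False
      then show ?thesis using that by (simp add: \<delta>_def joinpaths_def)
    qed
    have near: "\<delta> t \<in> ball x r" if "t \<in> {1/2..1}" for t
    proof -
      have "linepath x v (2 * t - 1) \<in> closed_segment x v"
        unfolding path_image_linepath[symmetric] path_image_def using that by (intro imageI) auto
      then show ?thesis using seg line[of t] that by auto
    qed
    \<comment> \<open>The path may have a corner at \<open>1/2\<close>, so differentiability is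
      asked for only in the interior, with continuity at the ends.\<close>
    have "(?F has_integral (P (\<delta> 1) - P (\<delta> (1/2)))) {1/2..1}"
    proof (rule fundamental_theorem_of_calculus_interior)
      have "continuous_on (ball x r) P"
        using P by (meson DERIV_isCont continuous_at_imp_continuous_on)
      moreover have "continuous_on {1/2..1} \<delta>"
        using \<delta> continuous_on_subset[of "{0..1}" \<delta> "{1/2..1}"]
        by (auto simp: path_from_in_def path_def)
      ultimately show "continuous_on {1/2..1} (\<lambda>t. P (\<delta> t))"
        by (rule continuous_on_compose2) (use near in auto)
      fix t :: real assume t: "t \<in> {1/2<..<1}"
      have "((\<lambda>t. linepath x v (2 * t - 1)) has_vector_derivative 2 *\<^sub>R (v - x)) (at t)"
        unfolding linepath_def
        by (auto intro!: derivative_eq_intros simp: algebra_simps scaleR_conv_of_real)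
      then have D: "(\<delta> has_vector_derivative 2 *\<^sub>R (v - x)) (at t)"
        using t line
        by (rule_tac has_vector_derivative_transform_within_open[where S = "{1/2<..}"]) auto
      then have "vector_derivative \<delta> (at t within {0..1}) = 2 *\<^sub>R (v - x)"
        using t by (intro vector_derivative_at_within_ivl) auto
      then show "((\<lambda>t. P (\<delta> t)) has_vector_derivative ?F t) (at t)"
        using field_vector_diff_chain_at[OF D P[OF near]] t by (simp add: o_def mult.commute)
    qed auto
    then have "integral {1/2..1} ?F = P v - P x"
      using half one by (simp add: integral_unique)
    moreover have "?F integrable_on {0..1}"
      using has_contour_integral_path_integral[OF int \<delta>] subsetD[OF r(2) v]
      by (auto simp: has_contour_integral_def integrable_on_def)
    then have "integral {0..1/2} ?F + integral {1/2..1} ?F = integral {0..1} ?F"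
      by (intro Henstock_Kurzweil_Integration.integral_combine) auto
    \<comment> \<open>Both path integrals are read off the single path \<open>\<delta>\<close>: the
      one to \<open>x\<close> at parameter \<open>1/2\<close>, the one to \<open>v\<close> at
      parameter \<open>1\<close>.\<close>
    ultimately show ?thesis
      using path_integral_along_path[OF int \<delta>, of 1] path_integral_along_path[OF int \<delta>, of "1/2"]
        half one by (simp add: add.commute)
  qed
  have "((\<lambda>v. P v - P x + path_integral U f a x) has_field_derivative f x) (at x)"
    using P[of x] r by (auto intro!: derivative_eq_intros)
  then show ?thesis
    by (rule has_field_derivative_transform_within_open[OF _ open_ball[of x r]]) (use r eq in auto)
qed

section \<open>Holomorphic images of paths and substitution\<close>

text \<open>
  The starting point \<open>a\<close> of \<open>\<gamma>\<close> may lie outside the domain of \<open>h\<close>, so the image path is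
  given its limit \<open>b\<close> there by hand.
\<close>

lemma path_from_in_compose_holomorphic:
  assumes "open V" and \<gamma>: "path_from_in V a z \<gamma>" and hol: "h holomorphic_on V" and "h ` V \<subseteq> U"
    and lim: "((\<lambda>t. h (\<gamma> t)) \<longlongrightarrow> b) (at 0 within {0..1})"
  shows "path_from_in U b (h z) (\<lambda>t. if t = 0 then b else h (\<gamma> t))" (is "path_from_in _ _ _ ?\<delta>")
proof -
  have inV: "\<gamma> t \<in> V" if "t \<in> {0<..1}" for t
    using \<gamma> that by (auto simp: path_from_in_def)
  have cont: "continuous_on {0..1} \<gamma>"
    using \<gamma> by (simp add: path_from_in_def path_def)
  have "(?\<delta> \<longlongrightarrow> ?\<delta> t) (at t within {0..1})" if t: "t \<in> {0..1}" for t
  proof (cases "t = 0")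
    case True
    have "\<forall>\<^sub>F t in at 0 within {0..1}. h (\<gamma> t) = ?\<delta> t"
      by (auto simp: eventually_at_filter)
    with lim show ?thesis
      using True Lim_transform_eventually by force
  next
    case False
    have "isCont h (\<gamma> t)"
      using inV False t hol \<open>open V\<close>
      by (auto intro!: field_differentiable_imp_continuous_at holomorphic_on_imp_differentiable_at)
    moreover have "(\<gamma> \<longlongrightarrow> \<gamma> t) (at t within {0..1})"
      using cont t by (simp add: continuous_on_def)
    ultimately have "((\<lambda>t. h (\<gamma> t)) \<longlongrightarrow> h (\<gamma> t)) (at t within {0..1})"
      by (rule isCont_tendsto_compose)
    moreover have "\<forall>\<^sub>F s in at t within {0..1}. h (\<gamma> s) = ?\<delta> s"
    proof -
      have "\<forall>\<^sub>F s in nhds t. s \<noteq> 0"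
        using False by (rule t1_space_nhds)
      then show ?thesis
        unfolding eventually_at_filter by eventually_elim auto
    qed
    ultimately show ?thesis
      using False Lim_transform_eventually by force
  qed
  then have cont\<delta>: "continuous_on {0..1} ?\<delta>"
    by (simp add: continuous_on_def)
  moreover have "?\<delta> piecewise_C1_differentiable_on {\<epsilon>..1}" if \<epsilon>: "\<epsilon> \<in> {0<..<1}" for \<epsilon>
  proof -
    obtain S D where "finite S" and contD: "continuous_on ({\<epsilon>..1} - S) D"
      and D: "\<And>t. t \<in> {\<epsilon>..1} - S \<Longrightarrow> (\<gamma> has_vector_derivative D t) (at t)"
      using \<gamma> \<epsilon> unfolding path_from_in_def piecewise_C1_differentiable_on_def
        C1_differentiable_on_def by metis
    \<comment> \<open>For positive parameters the special value \<open>b\<close> is invisible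
      locally, so the chain rule applies. The derivative is kept as an explicit formula because its
      continuity is needed next.\<close>
    have "(?\<delta> has_vector_derivative D t * deriv h (\<gamma> t)) (at t)" if t: "t \<in> {\<epsilon>..1} - S" for t
    proof -
      have "(h has_field_derivative deriv h (\<gamma> t)) (at (\<gamma> t))"
        using t \<epsilon> inV hol \<open>open V\<close> by (intro holomorphic_derivI) auto
      from field_vector_diff_chain_at[OF D[OF t] this] show ?thesis
        by (rule has_vector_derivative_transform_within_open[where S = "{0<..}"])
           (use t \<epsilon> in auto)
    qed
    moreover have "continuous_on ({\<epsilon>..1} - S) (\<lambda>t. D t * deriv h (\<gamma> t))"
    proof (intro continuous_on_mult contD continuous_on_compose2[of V "deriv h" _ \<gamma>])
      show "continuous_on V (deriv h)"
        using hol \<open>open V\<close> by (intro holomorphic_on_imp_continuous_on holomorphic_deriv)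
      show "continuous_on ({\<epsilon>..1} - S) \<gamma>"
        using \<epsilon> by (intro continuous_on_subset[OF cont]) auto
    qed (use inV \<epsilon> in auto)
    ultimately have "?\<delta> C1_differentiable_on {\<epsilon>..1} - S"
      unfolding C1_differentiable_on_def
      by (intro exI[of _ "\<lambda>t. D t * deriv h (\<gamma> t)"] conjI ballI)
    moreover have "continuous_on {\<epsilon>..1} ?\<delta>"
      using \<epsilon> by (intro continuous_on_subset[OF cont\<delta>]) auto
    ultimately show ?thesis
      using \<open>finite S\<close> unfolding piecewise_C1_differentiable_on_def by blast
  qed
  moreover have "h (\<gamma> 1) = h z"
    using \<gamma> by (simp add: path_from_in_def pathfinish_def)
  moreover have "?\<delta> ` {0<..1} \<subseteq> U"
    using inV assms(4) by auto
  ultimately show ?thesis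
    unfolding path_from_in_def path_def pathstart_def pathfinish_def by auto
qed

text \<open>By the chain rule the two integrands over \<open>{0..1}\<close> coincide off a
  negligible set, so the value passes from the image path back to \<open>\<gamma>\<close> without a
  convergence argument at the start. The value \<open>b\<close> affects a single parameter.\<close>

lemma has_contour_integral_substitution:
  assumes "open V" and \<gamma>: "path_from_in V a z \<gamma>" and hol: "h holomorphic_on V"
    and I: "(g has_contour_integral I) (\<lambda>t. if t = 0 then b else h (\<gamma> t))"
      (is "(_ has_contour_integral _) ?\<delta>")
    and eq: "\<And>v. v \<in> V \<Longrightarrow> k v = g (h v) * deriv h v"
  shows "(k has_contour_integral I) \<gamma>"
proof -
  let ?N = "{t \<in> {0<..1}. \<not> \<gamma> differentiable at t} \<union> {0}"
  have "k (\<gamma> t) * vector_derivative \<gamma> (at t within {0..1}) =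
          g (?\<delta> t) * vector_derivative ?\<delta> (at t within {0..1})" if t: "t \<in> {0..1} - ?N" for t
  proof -
    have D: "(\<gamma> has_vector_derivative vector_derivative \<gamma> (at t)) (at t)"
      using t by (auto simp: vector_derivative_works)
    have V: "\<gamma> t \<in> V"
      using \<gamma> t by (auto simp: path_from_in_def)
    then have "(h has_field_derivative deriv h (\<gamma> t)) (at (\<gamma> t))"
      using hol \<open>open V\<close> holomorphic_derivI by blast
    from field_vector_diff_chain_at[OF D this]
    have "(?\<delta> has_vector_derivative vector_derivative \<gamma> (at t) * deriv h (\<gamma> t)) (at t)"
      by (rule has_vector_derivative_transform_within_open[where S = "{0<..}"]) (use t in auto)
    then have "vector_derivative ?\<delta> (at t within {0..1}) = vector_derivative \<gamma> (at t) * deriv h (\<gamma> t)"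
      using t by (intro vector_derivative_at_within_ivl) auto
    moreover have "vector_derivative \<gamma> (at t within {0..1}) = vector_derivative \<gamma> (at t)"
      using t by (intro vector_derivative_at_within_ivl D) auto
    ultimately show ?thesis
      using t eq[OF V] by simp
  qed
  moreover have "negligible ?N"
    using path_from_in_countable_nondifferentiable[OF \<gamma>] by (intro countable_imp_negligible) auto
  ultimately show ?thesis
    using I unfolding has_contour_integral_def by (metis (no_types, lifting) has_integral_spike)
qed

section \<open>Change of variables by the inverse function\<close>

theorem theorem2:
  fixes U V W R :: "complex set"
    and \<rho> F1 G y w f :: "complex \<Rightarrow> complex"
    and c :: complex
  defines "q \<equiv> (\<lambda>A. exp (2 * of_real pi * \<i> * A))"
  defines "u \<equiv> (\<lambda>A. - w (q A) / (2 * of_real pi * \<i>) + c / (2 * of_real pi * \<i>))"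
  assumes "region U" and "region V" and "region W" and "region R"
    and "sixth_root_branch U \<rho>"
    and "local_inverse_F1 U \<rho> V F1"
    and "R \<subseteq> {A. Im A > 0}"
    and "G holomorphic_on U"
    and "y holomorphic_on R" and "y ` R \<subseteq> U"
    and "lagrange_solution f w" and "w holomorphic_on W" and "0 \<in> W" and "q ` R \<subseteq> W"
    and "\<And>A. A \<in> R \<Longrightarrow> path_integrable U (\<lambda>t. G t / (t * \<rho> t)) 0 (y A)"
    and "\<And>A. A \<in> R \<Longrightarrow> 5 * path_integral U (\<lambda>t. G t / (t * \<rho> t)) 0 (y A) = A"
    and "\<And>A. A \<in> R \<Longrightarrow> 5 * path_integral U (\<lambda>t. 1 / (t * \<rho> t)) 0 (y A) = u A"
  shows "\<exists>c'. \<forall>A\<in>R. path_integrable V (\<lambda>t. G (F1 t)) c' (u A) \<and>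
                     path_integral V (\<lambda>t. G (F1 t)) c' (u A) = A"
proof (intro exI[of _ 0] ballI)
  fix A assume A: "A \<in> R"
  define g where "g = (\<lambda>t. 1 / (t * \<rho> t))"
  define \<Phi> where "\<Phi> = (\<lambda>x. 5 * path_integral U g 0 x)"
  have "open U" "open V" "0 \<notin> U"
    using assms by (auto simp: region_def sixth_root_branch_def)
  have int: "\<And>x. x \<in> U \<Longrightarrow> path_integrable U g 0 x"
    and hom: "homeomorphism U V \<Phi> F1"
    and holF: "F1 holomorphic_on V" and limF: "(F1 \<longlongrightarrow> 0) (at 0 within V)"
    using \<open>local_inverse_F1 U \<rho> V F1\<close> by (auto simp: local_inverse_F1_def \<Phi>_def g_def)
  have F1V: "F1 ` V = U" and \<Phi>U: "\<Phi> ` U = V"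
    and F1\<Phi>: "\<And>x. x \<in> U \<Longrightarrow> F1 (\<Phi> x) = x" and \<Phi>F1: "\<And>v. v \<in> V \<Longrightarrow> \<Phi> (F1 v) = v"
    using hom by (auto simp: homeomorphism_def)
  have yU: "y A \<in> U" and \<Phi>y: "\<Phi> (y A) = u A"
    using assms A by (auto simp: \<Phi>_def g_def)
  then have F1u: "F1 (u A) = y A"
    using F1\<Phi> by force

  \<comment> \<open>Otherwise continuity and the prescribed limit would force
    \<open>F1 0 = 0\<close>, putting \<open>0\<close> into \<open>U\<close>. Hence paths in
    \<open>V\<close> avoid \<open>0\<close> after their start.\<close>
  have "0 \<notin> V"
  proof
    assume "0 \<in> V"
    then have "F1 \<midarrow>0\<rightarrow> F1 0"
      using holF \<open>open V\<close>
      by (intro isContD field_differentiable_imp_continuous_at holomorphic_on_imp_differentiable_at)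
    moreover have "F1 \<midarrow>0\<rightarrow> 0"
      using limF at_within_open[OF \<open>0 \<in> V\<close> \<open>open V\<close>] by simp
    ultimately have "F1 0 = 0"
      using LIM_unique by blast
    then show False
      using F1V \<open>0 \<in> V\<close> \<open>0 \<notin> U\<close> by force
  qed

  have D\<Phi>: "(\<Phi> has_field_derivative 5 * g x) (at x)" if "x \<in> U" for x
    unfolding \<Phi>_def
    using path_integral_has_field_derivative[OF \<open>open U\<close> int that] by (intro DERIV_cmult)
  then have hol\<Phi>: "\<Phi> holomorphic_on U"
    by (auto simp: holomorphic_on_def field_differentiable_def intro: has_field_derivative_at_within)
  \<comment> \<open>Differentiating \<open>\<Phi> (F1 v) = v\<close> yields the differential
    equation of \<open>F1\<close> in a product form that needs no division.\<close>
  have F1': "5 * g (F1 v) * deriv F1 v = 1" if "v \<in> V" for v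
  proof -
    have "(F1 has_field_derivative deriv F1 v) (at v)"
      using that holF \<open>open V\<close> by (intro holomorphic_derivI)
    moreover have "(\<Phi> has_field_derivative 5 * g (F1 v)) (at (F1 v))"
      using that F1V by (intro D\<Phi>) auto
    ultimately have "((\<lambda>v. \<Phi> (F1 v)) has_field_derivative 5 * g (F1 v) * deriv F1 v) (at v)"
      using DERIV_chain2 by blast
    then have "((\<lambda>v. v) has_field_derivative 5 * g (F1 v) * deriv F1 v) (at v)"
      by (rule has_field_derivative_transform_within_open[OF _ \<open>open V\<close> that]) (simp add: \<Phi>F1)
    then show ?thesis
      using DERIV_ident DERIV_unique by blast
  qed

  have holGF: "(\<lambda>t. G (F1 t)) holomorphic_on V"
    using holomorphic_on_compose_gen[OF holF \<open>G holomorphic_on U\<close>] F1V by (simp add: o_def)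
  obtain \<gamma> where \<gamma>: "path_from_in U 0 (y A) \<gamma>"
    using int[OF yU] by (auto simp: path_integrable_def)
  have "((\<lambda>t. \<Phi> (\<gamma> t)) \<longlongrightarrow> 0) (at 0 within {0..1})"
    unfolding \<Phi>_def using path_integral_tendsto_0[OF int \<gamma>] by (rule tendsto_mult_right_zero)
  then have ex: "\<exists>\<gamma>. path_from_in V 0 (u A) \<gamma>"
    using path_from_in_compose_holomorphic[OF \<open>open U\<close> \<gamma> hol\<Phi>] \<Phi>U \<Phi>y by (metis order_refl)

  \<comment> \<open>The path is arbitrary here, not just the image under \<open>\<Phi>\<close> found
    above, since integrability demands one value for all paths.\<close>
  have int_A: "((\<lambda>t. G (F1 t)) has_contour_integral A) \<gamma>" if \<gamma>: "path_from_in V 0 (u A) \<gamma>" for \<gamma>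
  proof -
    have "continuous_on {0..1} \<gamma>" "\<gamma> 0 = 0"
      using \<gamma> by (auto simp: path_from_in_def path_def pathstart_def)
    then have "(\<gamma> \<longlongrightarrow> 0) (at 0 within {0..1})"
      unfolding continuous_on_def by (metis atLeastAtMost_iff order_refl zero_le_one)
    \<comment> \<open>The limit of \<open>F1\<close> is over punctured neighbourhoods of
      \<open>0\<close> within \<open>V\<close>, so composing with \<open>\<gamma>\<close> requires
      both properties.\<close>
    moreover have "\<forall>\<^sub>F t in at 0 within {0..1}. \<gamma> t \<in> V \<and> \<gamma> t \<noteq> 0"
    proof -
      have "\<gamma> t \<in> V \<and> \<gamma> t \<noteq> 0" if "t \<in> {0<..1}" for t
        using \<gamma> \<open>0 \<notin> V\<close> that by (force simp: path_from_in_def)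
      then show ?thesis
        by (auto simp: eventually_at_filter)
    qed
    ultimately have "filterlim \<gamma> (at 0 within V) (at 0 within {0..1})"
      by (simp add: filterlim_at)
    with limF have "((\<lambda>t. F1 (\<gamma> t)) \<longlongrightarrow> 0) (at 0 within {0..1})"
      by (rule filterlim_compose)
    then have "path_from_in U 0 (y A) (\<lambda>t. if t = 0 then 0 else F1 (\<gamma> t))"
      using path_from_in_compose_holomorphic[OF \<open>open V\<close> \<gamma> holF] F1V F1u by force
    \<comment> \<open>\<open>assms(17)\<close> is path integrability of this integrand up to
      \<open>y A\<close>; \<open>assms(18)\<close>, used next, says that five times the integral is
      \<open>A\<close>.\<close>
    then have "((\<lambda>t. G t / (t * \<rho> t)) has_contour_integral path_integral U (\<lambda>t. G t / (t * \<rho> t)) 0 (y A))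
                 (\<lambda>t. if t = 0 then 0 else F1 (\<gamma> t))"
      using assms(17)[OF A] by (intro has_contour_integral_path_integral)
    from has_contour_integral_lmul[OF this, of 5]
    have "((\<lambda>t. 5 * (G t / (t * \<rho> t))) has_contour_integral A) (\<lambda>t. if t = 0 then 0 else F1 (\<gamma> t))"
      using assms(18)[OF A] by simp
    moreover have "G (F1 v) = 5 * (G (F1 v) / (F1 v * \<rho> (F1 v))) * deriv F1 v" if "v \<in> V" for v
    proof -
      have "G (F1 v) = G (F1 v) * (5 * g (F1 v) * deriv F1 v)"
        using F1'[OF that] by simp
      then show ?thesis
        by (simp add: g_def mult_ac)
    qed
    ultimately show ?thesis
      by (rule has_contour_integral_substitution[OF \<open>open V\<close> \<gamma> holF])
  qed
  with holGF ex have "path_integrable V (\<lambda>t. G (F1 t)) 0 (u A)"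
    by (auto simp: path_integrable_def)
  with int_A ex show "path_integrable V (\<lambda>t. G (F1 t)) 0 (u A) \<and>
      path_integral V (\<lambda>t. G (F1 t)) 0 (u A) = A"
    using path_integral_eqI by blast
qed

end
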